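(* Let $k$ be a commutative ring, let $k\langle x_1,x_2,\ldots\rangle$ be the ring of polynomials over $k$ in noncommuting indeterminates, and let $S\subseteq k\langle x_1,x_2,\ldots\rangle$ be an $m$-system. For any $k$-algebra $R$, the family $$\mathcal{F}=\{I \text{ an ideal of } R : R/I \text{ satisfies some } f\in S\}$$ satisfies $(P_1)$. Hence, an ideal $I$ of $R$ that is maximal with respect to $R/I$ not being a PI algebra over $k$ is prime.
   Context: Rings and algebras are associative and unital, not necessarily commutative; "ideal" means two-sided ideal. A subset $S$ of a ring $A$ is an $m$-system if $1\in S$ and for all $a,b\in S$ there exists $r\in A$ with $arb\in S$. For $f(x_1,\dots,x_n)\in k\langle x_1,x_2,\ldots\rangle$ and a $k$-algebra $R$, $f(R)=\{f(r_1,\dots,r_n): r_i\in R\}$; $R$ satisfies $f$ if $f(R)=0$. The polynomial $f$ is monic if one of its monomials of highest total degree has coefficient $1$. $R$ is a PI algebra (polynomial identity algebra) over $k$ if it satisfies some monic $f\in k\langle x_1,x_2,\ldots\rangle$. A family $\mathcal{F}$ of ideals of $R$ satisfies $(P_1)$ if $R\in\mathcal{F}$, $\mathcal{F}$ is closed under products ($I,J\in\mathcal{F}\Rightarrow IJ\in\mathcal{F}$), and $\mathcal{F}$ is upward closed ($I\in\mathcal{F}$ and $J\supseteq I$ an ideal imply $J\in\mathcal{F}$). *)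

theory Defs
  imports "HOL-Algebra.Module" "HOL-Algebra.QuotRing" "HOL-Algebra.Ideal_Product"
begin

section \<open>Algebras over a commutative ring\<close>

text \<open>The locale \<^locale>\<open>algebra\<close> of the library demands a commutative multiplication on the
  algebra, hence this variant.\<close>

locale assoc_algebra = module K A + ring A for K (structure) and A (structure) +
  assumes smult_mult_left:
      "\<lbrakk>c \<in> carrier K; x \<in> carrier A; y \<in> carrier A\<rbrakk>
        \<Longrightarrow> (c \<odot>\<^bsub>A\<^esub> x) \<otimes>\<^bsub>A\<^esub> y = c \<odot>\<^bsub>A\<^esub> (x \<otimes>\<^bsub>A\<^esub> y)"
    and smult_mult_right:
      "\<lbrakk>c \<in> carrier K; x \<in> carrier A; y \<in> carrier A\<rbrakk>
        \<Longrightarrow> x \<otimes>\<^bsub>A\<^esub> (c \<odot>\<^bsub>A\<^esub> y) = c \<odot>\<^bsub>A\<^esub> (x \<otimes>\<^bsub>A\<^esub> y)"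

definition quot_algebra :: "('k, 'a, 'm) module_scheme \<Rightarrow> 'a set \<Rightarrow> ('k, 'a set) module"
  where "quot_algebra A I =
    \<lparr>carrier = carrier (A Quot I), mult = mult (A Quot I), one = one (A Quot I),
      zero = zero (A Quot I), add = add (A Quot I),
      smult = (\<lambda>c U. (\<Union>x\<in>U. I +>\<^bsub>A\<^esub> (c \<odot>\<^bsub>A\<^esub> x)))\<rparr>"

section \<open>Polynomials in noncommuting indeterminates\<close>

text \<open>A polynomial is its coefficient function on words; the word \<open>[i\<^sub>1, \<dots>, i\<^sub>d]\<close> stands for the
  monomial \<open>x\<^bsub>i\<^sub>1\<^esub> \<cdots> x\<^bsub>i\<^sub>d\<^esub>\<close>, the indeterminates being indexed from \<open>0\<close>.\<close>

definition free_algebra :: "('k, 'n) ring_scheme \<Rightarrow> ('k, nat list \<Rightarrow> 'k) module"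
  where "free_algebra K =
    \<lparr>carrier = {f. (\<forall>w. f w \<in> carrier K) \<and> finite {w. f w \<noteq> \<zero>\<^bsub>K\<^esub>}},
      mult = (\<lambda>f g w. (\<Oplus>\<^bsub>K\<^esub>i\<in>{..length w}. f (take i w) \<otimes>\<^bsub>K\<^esub> g (drop i w))),
      one = (\<lambda>w. if w = [] then \<one>\<^bsub>K\<^esub> else \<zero>\<^bsub>K\<^esub>),
      zero = (\<lambda>w. \<zero>\<^bsub>K\<^esub>),
      add = (\<lambda>f g w. f w \<oplus>\<^bsub>K\<^esub> g w),
      smult = (\<lambda>c f w. c \<otimes>\<^bsub>K\<^esub> f w)\<rparr>"

definition eval_word :: "('a, 'm) ring_scheme \<Rightarrow> (nat \<Rightarrow> 'a) \<Rightarrow> nat list \<Rightarrow> 'a"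
  where "eval_word A r w = foldr (\<lambda>i y. r i \<otimes>\<^bsub>A\<^esub> y) w \<one>\<^bsub>A\<^esub>"

definition eval_poly ::
    "('k, 'n) ring_scheme \<Rightarrow> ('k, 'a, 'm) module_scheme \<Rightarrow> (nat \<Rightarrow> 'a) \<Rightarrow> (nat list \<Rightarrow> 'k) \<Rightarrow> 'a"
  where "eval_poly K A r f =
    (\<Oplus>\<^bsub>A\<^esub>w\<in>{w. f w \<noteq> \<zero>\<^bsub>K\<^esub>}. f w \<odot>\<^bsub>A\<^esub> eval_word A r w)"

text \<open>Only finitely many indeterminates occur in \<open>f\<close>, so letting \<open>r\<close> range over all sequences in
  \<open>A\<close> gives the same set as substituting just for those that occur.\<close>

definition poly_image ::
    "('k, 'n) ring_scheme \<Rightarrow> ('k, 'a, 'm) module_scheme \<Rightarrow> (nat list \<Rightarrow> 'k) \<Rightarrow> 'a set"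
  where "poly_image K A f = {eval_poly K A r f | r. r \<in> UNIV \<rightarrow> carrier A}"

definition satisfies ::
    "('k, 'n) ring_scheme \<Rightarrow> ('k, 'a, 'm) module_scheme \<Rightarrow> (nat list \<Rightarrow> 'k) \<Rightarrow> bool"
  where "satisfies K A f \<longleftrightarrow> poly_image K A f = {\<zero>\<^bsub>A\<^esub>}"

text \<open>If \<open>K\<close> is the zero ring, then the zero polynomial is monic: there \<open>0 = 1\<close>, and the
  polynomial \<open>1\<close> has to be monic.\<close>

definition monic_poly :: "('k, 'n) ring_scheme \<Rightarrow> (nat list \<Rightarrow> 'k) \<Rightarrow> bool"
  where "monic_poly K f \<longleftrightarrow>
    (\<exists>w. f w = \<one>\<^bsub>K\<^esub> \<and> (\<forall>v. f v \<noteq> \<zero>\<^bsub>K\<^esub> \<longrightarrow> length v \<le> length w))"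

definition PI_algebra :: "('k, 'n) ring_scheme \<Rightarrow> ('k, 'a, 'm) module_scheme \<Rightarrow> bool"
  where "PI_algebra K A \<longleftrightarrow>
    (\<exists>f\<in>carrier (free_algebra K). monic_poly K f \<and> satisfies K A f)"

section \<open>Notions for noncommutative rings\<close>

definition m_system :: "('a, 'm) ring_scheme \<Rightarrow> 'a set \<Rightarrow> bool"
  where "m_system A S \<longleftrightarrow> S \<subseteq> carrier A \<and> \<one>\<^bsub>A\<^esub> \<in> S \<and>
    (\<forall>a\<in>S. \<forall>b\<in>S. \<exists>r\<in>carrier A. a \<otimes>\<^bsub>A\<^esub> r \<otimes>\<^bsub>A\<^esub> b \<in> S)"

definition satisfies_P1 :: "('a, 'm) ring_scheme \<Rightarrow> 'a set set \<Rightarrow> bool"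
  where "satisfies_P1 A \<F> \<longleftrightarrow>
    (\<forall>I\<in>\<F>. ideal I A) \<and>
    carrier A \<in> \<F> \<and>
    (\<forall>I\<in>\<F>. \<forall>J\<in>\<F>. I \<cdot>\<^bsub>A\<^esub> J \<in> \<F>) \<and>
    (\<forall>I\<in>\<F>. \<forall>J. ideal J A \<and> I \<subseteq> J \<longrightarrow> J \<in> \<F>)"

text \<open>Primeness in the noncommutative sense, in terms of products of two-sided ideals; the library's
  \<^locale>\<open>primeideal\<close> is elementwise and confined to commutative rings.\<close>

definition prime_two_sided :: "('a, 'm) ring_scheme \<Rightarrow> 'a set \<Rightarrow> bool"
  where "prime_two_sided A P \<longleftrightarrow> ideal P A \<and> P \<noteq> carrier A \<and>
    (\<forall>I J. ideal I A \<and> ideal J A \<and> I \<cdot>\<^bsub>A\<^esub> J \<subseteq> P \<longrightarrow> I \<subseteq> P \<or> J \<subseteq> P)"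

section \<open>The quotient and the polynomial ring are algebras\<close>

lemma quot_smult:
  assumes "assoc_algebra K A" "ideal I A" "c \<in> carrier K" "x \<in> carrier A"
  shows "c \<odot>\<^bsub>quot_algebra A I\<^esub> (I +>\<^bsub>A\<^esub> x) = I +>\<^bsub>A\<^esub> (c \<odot>\<^bsub>A\<^esub> x)"
proof -
  interpret assoc_algebra K A by fact
  interpret ideal I A by fact
  have sI: "c \<odot>\<^bsub>A\<^esub> h \<in> I" if "h \<in> I" for h
  proof -
    have "c \<odot>\<^bsub>A\<^esub> h = (c \<odot>\<^bsub>A\<^esub> \<one>\<^bsub>A\<^esub>) \<otimes>\<^bsub>A\<^esub> h"
      using assms that smult_mult_left[of c "\<one>\<^bsub>A\<^esub>" h] a_Hcarr by auto
    then show ?thesis using that assms I_l_closed by auto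
  qed
  have "I +>\<^bsub>A\<^esub> (c \<odot>\<^bsub>A\<^esub> y) = I +>\<^bsub>A\<^esub> (c \<odot>\<^bsub>A\<^esub> x)" if y: "y \<in> I +>\<^bsub>A\<^esub> x" for y
  proof -
    obtain h where h: "h \<in> I" "y = h \<oplus>\<^bsub>A\<^esub> x" using y by (auto simp: a_r_coset_def r_coset_def)
    have "c \<odot>\<^bsub>A\<^esub> y = c \<odot>\<^bsub>A\<^esub> h \<oplus>\<^bsub>A\<^esub> c \<odot>\<^bsub>A\<^esub> x"
      using h assms smult_r_distr a_Hcarr by auto
    then have "c \<odot>\<^bsub>A\<^esub> y \<in> I +>\<^bsub>A\<^esub> (c \<odot>\<^bsub>A\<^esub> x)"
      using sI[OF h(1)] by (auto simp: a_r_coset_def r_coset_def)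
    then show ?thesis using a_repr_independence[OF _ smult_closed[OF assms(3,4)] a_subgroup] by simp
  qed
  moreover have "x \<in> I +>\<^bsub>A\<^esub> x" using a_rcos_self assms by auto
  ultimately have "(\<Union>y\<in>I +>\<^bsub>A\<^esub> x. I +>\<^bsub>A\<^esub> (c \<odot>\<^bsub>A\<^esub> y)) = I +>\<^bsub>A\<^esub> (c \<odot>\<^bsub>A\<^esub> x)" by blast
  then show ?thesis by (simp add: quot_algebra_def)
qed

lemma assoc_algebra_quot:
  fixes K (structure)
  assumes "assoc_algebra K A" "ideal I A"
  shows "assoc_algebra K (quot_algebra A I)"
proof -
  interpret assoc_algebra K A by fact
  interpret ideal I A by fact
  interpret Q: ring "A Quot I" by (rule quotient_is_ring)
  interpret h: ring_hom_ring A "A Quot I" "(+>\<^bsub>A\<^esub>) I" by (rule rcos_ring_hom_ring)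
  let ?Q = "quot_algebra A I"
  have sel: "carrier ?Q = carrier (A Quot I)" "mult ?Q = mult (A Quot I)" "one ?Q = one (A Quot I)"
    "zero ?Q = zero (A Quot I)" "add ?Q = add (A Quot I)" by (simp_all add: quot_algebra_def)
  have ag: "ring ?Q"
  proof (rule ringI[OF abelian_groupI monoidI])
    fix U assume "U \<in> carrier ?Q"
    then show "\<exists>V\<in>carrier ?Q. V \<oplus>\<^bsub>?Q\<^esub> U = \<zero>\<^bsub>?Q\<^esub>"
      unfolding sel by (intro bexI[of _ "\<ominus>\<^bsub>A Quot I\<^esub> U"] Q.l_neg Q.a_inv_closed)
  qed (unfold sel; (rule Q.a_closed Q.m_closed Q.zero_closed Q.one_closed Q.a_assoc Q.m_assoc Q.a_comm Q.l_zero Q.l_one Q.r_one Q.l_distr Q.r_distr; assumption))+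
  have c: "\<And>U. U \<in> carrier ?Q \<longleftrightarrow> (\<exists>x\<in>carrier A. U = I +>\<^bsub>A\<^esub> x)"
    by (auto simp: quot_algebra_def FactRing_def A_RCOSETS_def RCOSETS_def a_r_coset_def)
  have a: "(I +>\<^bsub>A\<^esub> x) \<oplus>\<^bsub>?Q\<^esub> (I +>\<^bsub>A\<^esub> y) = I +>\<^bsub>A\<^esub> (x \<oplus>\<^bsub>A\<^esub> y)"
    if "x \<in> carrier A" "y \<in> carrier A" for x y using h.hom_add that by (simp add: quot_algebra_def)
  have m: "(I +>\<^bsub>A\<^esub> x) \<otimes>\<^bsub>?Q\<^esub> (I +>\<^bsub>A\<^esub> y) = I +>\<^bsub>A\<^esub> (x \<otimes>\<^bsub>A\<^esub> y)"
    if "x \<in> carrier A" "y \<in> carrier A" for x y using h.hom_mult that by (simp add: quot_algebra_def)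
  note s = quot_smult[OF assms]
  show ?thesis
  proof (intro assoc_algebra.intro module.intro ring.is_abelian_group ag module_axioms.intro assoc_algebra_axioms.intro is_cring)
    fix d U assume h: "d \<in> carrier K" "U \<in> carrier ?Q"
    from h(2) obtain x where x: "x \<in> carrier A" "U = I +>\<^bsub>A\<^esub> x" by (auto simp: c)
    show "d \<odot>\<^bsub>?Q\<^esub> U \<in> carrier ?Q"
      unfolding c x(2) s[OF h(1) x(1)] using smult_closed[OF h(1) x(1)] by blast
  next
    fix d e U assume h: "d \<in> carrier K" "e \<in> carrier K" "U \<in> carrier ?Q"
    then obtain x where x: "x \<in> carrier A" "U = I +>\<^bsub>A\<^esub> x" using c by blast
    show "(d \<oplus> e) \<odot>\<^bsub>?Q\<^esub> U = d \<odot>\<^bsub>?Q\<^esub> U \<oplus>\<^bsub>?Q\<^esub> e \<odot>\<^bsub>?Q\<^esub> U"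
      "(d \<otimes> e) \<odot>\<^bsub>?Q\<^esub> U = d \<odot>\<^bsub>?Q\<^esub> (e \<odot>\<^bsub>?Q\<^esub> U)"
      using h(1,2) x by (simp_all add: s a smult_l_distr smult_assoc1 del: h.hom_add h.hom_mult)
  next
    fix d U V assume h: "d \<in> carrier K" "U \<in> carrier ?Q" "V \<in> carrier ?Q"
    from h(2) obtain x where x: "x \<in> carrier A" "U = I +>\<^bsub>A\<^esub> x" by (auto simp: c)
    from h(3) obtain y where y: "y \<in> carrier A" "V = I +>\<^bsub>A\<^esub> y" by (auto simp: c)
    show "d \<odot>\<^bsub>?Q\<^esub> (U \<oplus>\<^bsub>?Q\<^esub> V) = d \<odot>\<^bsub>?Q\<^esub> U \<oplus>\<^bsub>?Q\<^esub> d \<odot>\<^bsub>?Q\<^esub> V"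
      "d \<odot>\<^bsub>?Q\<^esub> U \<otimes>\<^bsub>?Q\<^esub> V = d \<odot>\<^bsub>?Q\<^esub> (U \<otimes>\<^bsub>?Q\<^esub> V)"
      "U \<otimes>\<^bsub>?Q\<^esub> (d \<odot>\<^bsub>?Q\<^esub> V) = d \<odot>\<^bsub>?Q\<^esub> (U \<otimes>\<^bsub>?Q\<^esub> V)"
      using h(1) x y by (simp_all add: s a m smult_r_distr smult_mult_left smult_mult_right del: h.hom_add h.hom_mult)
  next
    fix U assume "U \<in> carrier ?Q"
    then obtain x where x: "x \<in> carrier A" "U = I +>\<^bsub>A\<^esub> x" using c by blast
    then show "\<one> \<odot>\<^bsub>?Q\<^esub> U = U" by (simp add: s)
  qed
qed

lemma assoc_algebra_free:
  fixes K (structure)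
  assumes "cring K"
  shows "assoc_algebra K (free_algebra K)"
proof -
  interpret cring K by fact
  define C where "C = {f. (\<forall>w::nat list. f w \<in> carrier K) \<and> finite {w. f w \<noteq> \<zero>}}"
  define M where "M = (\<lambda>f g (w::nat list). (\<Oplus>i\<in>{..length w}. f (take i w) \<otimes> g (drop i w)))"
  have Cc: "f w \<in> carrier K" if "f \<in> C" for f w using that by (auto simp: C_def)
  have Mc: "M f g w \<in> carrier K" if "\<And>w. f w \<in> carrier K" "\<And>w. g w \<in> carrier K" for f g w
    unfolding M_def using that by (intro finsum_closed) auto
  have Mnil: "M f g [] = f [] \<otimes> g []" if "\<And>w. f w \<in> carrier K" "\<And>w. g w \<in> carrier K" for f g
    unfolding M_def using that by simp
  have Mcons: "M f g (x # w) = M (\<lambda>v. f (x # v)) g w \<oplus> f [] \<otimes> g (x # w)"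
    if "\<And>w. f w \<in> carrier K" "\<And>w. g w \<in> carrier K" for f g x w
    unfolding M_def using that by (simp add: finsum_Suc2 del: finsum_Suc)
  have Madd1: "M (\<lambda>w. f w \<oplus> g w) h w = M f h w \<oplus> M g h w"
    if "\<And>w. f w \<in> carrier K" "\<And>w. g w \<in> carrier K" "\<And>w. h w \<in> carrier K" for f g h w
    unfolding M_def using that by (simp add: l_distr finsum_addf Pi_def)
  have Madd2: "M h (\<lambda>w. f w \<oplus> g w) w = M h f w \<oplus> M h g w"
    if "\<And>w. f w \<in> carrier K" "\<And>w. g w \<in> carrier K" "\<And>w. h w \<in> carrier K" for f g h w
    unfolding M_def using that by (simp add: r_distr finsum_addf Pi_def)
  have Ms1: "M (\<lambda>w. c \<otimes> f w) g w = c \<otimes> M f g w"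
    if "c \<in> carrier K" "\<And>w. f w \<in> carrier K" "\<And>w. g w \<in> carrier K" for c f g w
    unfolding M_def using that by (simp add: finsum_rdistr Pi_def m_assoc)
  have Ms2: "M f (\<lambda>w. c \<otimes> g w) w = c \<otimes> M f g w"
    if "c \<in> carrier K" "\<And>w. f w \<in> carrier K" "\<And>w. g w \<in> carrier K" for c f g w
    unfolding M_def using that by (simp add: finsum_rdistr Pi_def m_lcomm)
  have Massoc: "M (M f g) h w = M f (M g h) w"
    if "\<And>w. f w \<in> carrier K" "\<And>w. g w \<in> carrier K" "\<And>w. h w \<in> carrier K" for f g h w
    using that
  proof (induction w arbitrary: f g h)
    case Nil then show ?case by (simp add: Mnil Mc m_assoc)
  next
    case (Cons x w)
    have "M (M f g) h (x # w) = M (\<lambda>v. M f g (x # v)) h w \<oplus> M f g [] \<otimes> h (x # w)"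
      using Cons.prems by (simp add: Mcons Mc)
    also have "(\<lambda>v. M f g (x # v)) = (\<lambda>v. M (\<lambda>v. f (x # v)) g v \<oplus> f [] \<otimes> g (x # v))"
      using Cons.prems by (simp add: Mcons Mc)
    also have "M \<dots> h w = M (\<lambda>v. f (x # v)) (M g h) w \<oplus> f [] \<otimes> M (\<lambda>v. g (x # v)) h w"
      using Cons.prems by (simp add: Madd1 Ms1 Mc Cons.IH)
    finally show ?case using Cons.prems
      by (simp add: Mcons Mc Mnil r_distr m_assoc a_assoc)
  qed
  have Mfin: "finite {w. M f g w \<noteq> \<zero>}" if "f \<in> C" "g \<in> C" for f g
  proof (rule finite_subset)
    show "{w. M f g w \<noteq> \<zero>} \<subseteq> (\<lambda>(u,v). u @ v) ` ({w. f w \<noteq> \<zero>} \<times> {w. g w \<noteq> \<zero>})"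
    proof
      fix w assume w: "w \<in> {w. M f g w \<noteq> \<zero>}"
      have "\<exists>i\<in>{..length w}. f (take i w) \<otimes> g (drop i w) \<noteq> \<zero>"
      proof (rule ccontr)
        assume "\<not> ?thesis"
        then have "M f g w = (\<Oplus>i\<in>{..length w}. \<zero>)"
          unfolding M_def by (intro finsum_cong') auto
        then show False using w by simp
      qed
      then obtain i where i: "f (take i w) \<otimes> g (drop i w) \<noteq> \<zero>" by auto
      then have "f (take i w) \<noteq> \<zero>" "g (drop i w) \<noteq> \<zero>" using Cc that by auto
      then show "w \<in> (\<lambda>(u,v). u @ v) ` ({w. f w \<noteq> \<zero>} \<times> {w. g w \<noteq> \<zero>})"
        by (auto intro!: image_eqI[of _ _ "(take i w, drop i w)"])
    qed
    show "finite ((\<lambda>(u,v). u @ v) ` ({w. f w \<noteq> \<zero>} \<times> {w. g w \<noteq> \<zero>}))"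
      using that by (auto simp: C_def)
  qed
  define e where "e = (\<lambda>w::nat list. if w = [] then \<one> else \<zero>)"
  have ec: "e w \<in> carrier K" for w by (auto simp: e_def)
  have z: "M (\<lambda>v. \<zero>) f w = \<zero>" if "\<And>w. f w \<in> carrier K" for f w
    unfolding M_def using that by simp
  have M1: "M e f w = f w" if "\<And>w. f w \<in> carrier K" for f w
  proof (cases w)
    case Nil then show ?thesis using that ec by (simp add: Mnil) (simp add: e_def)
  next
    case (Cons x v)
    have "(\<lambda>v. e (x # v)) = (\<lambda>v. \<zero>)" by (simp add: e_def)
    then show ?thesis using Cons that ec by (simp add: Mcons z) (simp add: e_def)
  qed
  have M2: "M f e w = f w" if "\<And>w. f w \<in> carrier K" for f w using that
  proof (induction w arbitrary: f)
    case Nil then show ?case using ec by (simp add: Mnil) (simp add: e_def)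
  next
    case (Cons x v)
    then show ?case using ec by (simp add: Mcons) (simp add: e_def)
  qed
  have F: "free_algebra K = \<lparr>carrier = C, mult = M, one = e, zero = (\<lambda>w. \<zero>),
      add = (\<lambda>f g w. f w \<oplus> g w), smult = (\<lambda>c f w. c \<otimes> f w)\<rparr>"
    by (simp add: free_algebra_def C_def M_def e_def)
  have add: "(\<lambda>w. f w \<oplus> g w) \<in> C" if "f \<in> C" "g \<in> C" for f g
  proof -
    have "{w. f w \<oplus> g w \<noteq> \<zero>} \<subseteq> {w. f w \<noteq> \<zero>} \<union> {w. g w \<noteq> \<zero>}" by auto
    then show ?thesis using that finite_subset by (fastforce simp: C_def)
  qed
  have smu: "(\<lambda>w. c \<otimes> f w) \<in> C" if "c \<in> carrier K" "f \<in> C" for c f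
  proof -
    have "{w. c \<otimes> f w \<noteq> \<zero>} \<subseteq> {w. f w \<noteq> \<zero>}" using that by auto
    then show ?thesis using that finite_subset by (fastforce simp: C_def)
  qed
  have neg: "\<exists>g\<in>C. (\<lambda>w. g w \<oplus> f w) = (\<lambda>w. \<zero>)" if "f \<in> C" for f
    using smu[of "\<ominus> \<one>" f] that Cc
    by (intro bexI[of _ "\<lambda>w. \<ominus> \<one> \<otimes> f w"]) (auto simp: l_minus l_neg)
  have zC: "(\<lambda>w. \<zero>) \<in> C" by (simp add: C_def)
  have eC: "e \<in> C" unfolding C_def e_def by auto
  have MC: "M f g \<in> C" if "f \<in> C" "g \<in> C" for f g
    using Mfin[OF that] Mc[OF Cc[OF that(1)] Cc[OF that(2)]] by (simp add: C_def)
  have rng: "ring (free_algebra K)"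
  proof (rule ringI[OF abelian_groupI monoidI])
    fix f assume "f \<in> carrier (free_algebra K)"
    then show "\<exists>g\<in>carrier (free_algebra K). g \<oplus>\<^bsub>free_algebra K\<^esub> f = \<zero>\<^bsub>free_algebra K\<^esub>"
      using neg by (simp add: F)
  qed (simp_all add: F add zC eC MC a_assoc a_comm a_lcomm Cc Massoc M1 M2 Madd1 Madd2 fun_eq_iff)
  show ?thesis
    apply (intro assoc_algebra.intro module.intro ring.is_abelian_group rng module_axioms.intro assoc_algebra_axioms.intro is_cring)
    by (simp_all add: F smu Cc Ms1 Ms2 fun_eq_iff l_distr r_distr m_assoc)
qed

end

theory Submission
  imports Defs
begin

text \<open>Evaluation of noncommutative polynomials is a ring homomorphism and commutes with passage to
  quotients, so \<open>R/I\<close> satisfies \<open>f\<close> iff \<open>f(R) \<subseteq> I\<close>. If \<open>f(R) \<subseteq> I\<close>, \<open>g(R) \<subseteq> J\<close> and \<open>f h g \<in> S\<close>, then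
  \<open>(f h g)(R) \<subseteq> I J\<close>; this is closure under products. The monic polynomials form an \<open>m\<close>-system, since the
  product of the two monic monomials of top degree has a unique factorization with nonzero
  contribution. If \<open>P\<close> is maximal outside a family with \<open>(P\<^sub>1)\<close> and the ideals \<open>I\<close>, \<open>J\<close> are not
  contained in \<open>P\<close>, then \<open>I + P\<close> and \<open>J + P\<close> lie in the family; so does their product, which
  would lie in \<open>P\<close> if \<open>I J \<subseteq> P\<close>.\<close>

section \<open>Evaluation of polynomials\<close>

lemma carrier_free_algebra:
  "f \<in> carrier (free_algebra K) \<longleftrightarrow> (\<forall>w. f w \<in> carrier K) \<and> finite {w. f w \<noteq> \<zero>\<^bsub>K\<^esub>}"
  by (simp add: free_algebra_def)

lemma mult_free_algebra:
  "(f \<otimes>\<^bsub>free_algebra K\<^esub> g) w = (\<Oplus>\<^bsub>K\<^esub>i\<in>{..length w}. f (take i w) \<otimes>\<^bsub>K\<^esub> g (drop i w))"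
  by (simp add: free_algebra_def)

lemma add_free_algebra: "(f \<oplus>\<^bsub>free_algebra K\<^esub> g) w = f w \<oplus>\<^bsub>K\<^esub> g w"
  by (simp add: free_algebra_def)

lemma one_free_algebra: "\<one>\<^bsub>free_algebra K\<^esub> w = (if w = [] then \<one>\<^bsub>K\<^esub> else \<zero>\<^bsub>K\<^esub>)"
  by (simp add: free_algebra_def)

section \<open>Monomials and left multiplication by them\<close>

definition monomial :: "('k, 'n) ring_scheme \<Rightarrow> nat list \<Rightarrow> 'k \<Rightarrow> nat list \<Rightarrow> 'k"
  where "monomial K u c = (\<lambda>w. if w = u then c else \<zero>\<^bsub>K\<^esub>)"

context cring
begin

lemma monomial_closed [simp, intro]:
  "c \<in> carrier R \<Longrightarrow> monomial R u c \<in> carrier (free_algebra R)"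
  by (auto simp: carrier_free_algebra monomial_def)

text \<open>Only the cut after \<open>length u\<close> letters gives \<open>u @ v\<close> the left
  part \<open>u\<close>, so the convolution sum collapses to one term.\<close>

lemma monomial_mult_append:
  assumes "c \<in> carrier R" "g \<in> carrier (free_algebra R)"
  shows "(monomial R u c \<otimes>\<^bsub>free_algebra R\<^esub> g) (u @ v) = c \<otimes> g v"
proof -
  have g: "g w \<in> carrier R" for w using assms(2) by (simp add: carrier_free_algebra)
  have "(monomial R u c \<otimes>\<^bsub>free_algebra R\<^esub> g) (u @ v) =
      (\<Oplus>i\<in>{..length (u @ v)}. if length u = i then c \<otimes> g (drop i (u @ v)) else \<zero>)"
    unfolding mult_free_algebra
  proof (rule finsum_cong'[OF refl])
    fix i assume i: "i \<in> {..length (u @ v)}"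
    \<comment> \<open>The bound on \<open>i\<close> matters: up to it, \<open>take i\<close> yields
      a word of length exactly \<open>i\<close>, so comparing lengths suffices.\<close>
    have "take i (u @ v) = u \<longleftrightarrow> length u = i"
    proof
      assume "take i (u @ v) = u"
      from arg_cong[OF this, of length] i show "length u = i" by simp
    qed auto
    then show "monomial R u c (take i (u @ v)) \<otimes> g (drop i (u @ v)) =
        (if length u = i then c \<otimes> g (drop i (u @ v)) else \<zero>)"
      using g by (auto simp: monomial_def simp del: take_append drop_append)
  qed (use assms(1) g in auto)
  also have "\<dots> = c \<otimes> g v"
    by (subst finsum_singleton) (use assms(1) g in auto)
  finally show ?thesis .
qed

text \<open>Bounds the support of the product: a word that does not start with \<open>u\<close> gets
  only zero summands, and at \<open>u @ v\<close> the coefficient is \<open>c \<otimes> g v\<close>,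
  which vanishes with \<open>g v\<close>.\<close>

lemma monomial_mult_nonzero:
  assumes "c \<in> carrier R" "g \<in> carrier (free_algebra R)"
    and "(monomial R u c \<otimes>\<^bsub>free_algebra R\<^esub> g) w \<noteq> \<zero>"
  shows "\<exists>v. w = u @ v \<and> g v \<noteq> \<zero>"
proof -
  have g: "g w \<in> carrier R" for w using assms(2) by (simp add: carrier_free_algebra)
  have "\<exists>i. take i w = u"
  proof (rule ccontr)
    assume "\<not> ?thesis"
    then have "(monomial R u c \<otimes>\<^bsub>free_algebra R\<^esub> g) w = (\<Oplus>i\<in>{..length w}. \<zero>)"
      unfolding mult_free_algebra using g by (intro finsum_cong') (auto simp: monomial_def)
    then show False using assms(3) by simp
  qed
  then obtain v where v: "w = u @ v" by (metis append_take_drop_id)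
  then have "c \<otimes> g v \<noteq> \<zero>" using assms monomial_mult_append by simp
  then show ?thesis using v assms(1) by auto
qed

end

section \<open>Evaluation as a ring homomorphism\<close>

lemma eval_word_simps [simp]:
  "eval_word A r [] = \<one>\<^bsub>A\<^esub>"
  "eval_word A r (i # w) = r i \<otimes>\<^bsub>A\<^esub> eval_word A r w"
  by (simp_all add: eval_word_def)

context assoc_algebra
begin

lemma eval_word_closed [simp, intro]:
  "r \<in> UNIV \<rightarrow> carrier A \<Longrightarrow> eval_word A r w \<in> carrier A"
  by (induction w) auto

lemma eval_word_append:
  assumes "r \<in> UNIV \<rightarrow> carrier A"
  shows "eval_word A r (u @ v) = eval_word A r u \<otimes>\<^bsub>A\<^esub> eval_word A r v"
proof (induction u)
  case Nil
  show ?case using eval_word_closed[OF assms, of v] by simp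
next
  case (Cons i u)
  have "r i \<in> carrier A" using assms by auto
  then show ?case using Cons assms by (simp add: m_assoc)
qed

text \<open>Words outside the support contribute zero. The freedom in \<open>W\<close> allows one
  index set for several polynomials, even when a support shrinks by cancellation.\<close>

lemma eval_poly_superset:
  assumes "f \<in> carrier (free_algebra K)" "r \<in> UNIV \<rightarrow> carrier A"
    and "finite W" "{w. f w \<noteq> \<zero>} \<subseteq> W"
  shows "eval_poly K A r f = (\<Oplus>\<^bsub>A\<^esub>w\<in>W. f w \<odot>\<^bsub>A\<^esub> eval_word A r w)"
  unfolding eval_poly_def using assms
  by (intro M.add.finprod_mono_neutral_cong_left) (auto simp: carrier_free_algebra)

lemma eval_poly_closed [simp, intro]:
  assumes "f \<in> carrier (free_algebra K)" "r \<in> UNIV \<rightarrow> carrier A"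
  shows "eval_poly K A r f \<in> carrier A"
  unfolding eval_poly_def using assms
  by (intro M.finsum_closed) (auto simp: carrier_free_algebra)

lemma eval_poly_add:
  assumes "f \<in> carrier (free_algebra K)" "g \<in> carrier (free_algebra K)"
    and "r \<in> UNIV \<rightarrow> carrier A"
  shows "eval_poly K A r (f \<oplus>\<^bsub>free_algebra K\<^esub> g) = eval_poly K A r f \<oplus>\<^bsub>A\<^esub> eval_poly K A r g"
proof -
  interpret F: assoc_algebra K "free_algebra K" by (rule assoc_algebra_free[OF is_cring])
  let ?W = "{w. f w \<noteq> \<zero>} \<union> {w. g w \<noteq> \<zero>}"
  have W: "finite ?W" using assms by (simp add: carrier_free_algebra)
  have c: "f w \<in> carrier K" "g w \<in> carrier K" for w using assms by (auto simp: carrier_free_algebra)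
  have "{w. (f \<oplus>\<^bsub>free_algebra K\<^esub> g) w \<noteq> \<zero>} \<subseteq> ?W"
    by (auto simp: add_free_algebra)
  then have "eval_poly K A r (f \<oplus>\<^bsub>free_algebra K\<^esub> g) =
      (\<Oplus>\<^bsub>A\<^esub>w\<in>?W. (f w \<oplus> g w) \<odot>\<^bsub>A\<^esub> eval_word A r w)"
    using eval_poly_superset[OF F.M.a_closed[OF assms(1,2)] assms(3) W]
    by (simp only: add_free_algebra)
  also have "\<dots> = (\<Oplus>\<^bsub>A\<^esub>w\<in>?W. f w \<odot>\<^bsub>A\<^esub> eval_word A r w) \<oplus>\<^bsub>A\<^esub>
      (\<Oplus>\<^bsub>A\<^esub>w\<in>?W. g w \<odot>\<^bsub>A\<^esub> eval_word A r w)"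
    using assms(3) c by (simp add: smult_l_distr Pi_def)
  also have "\<dots> = eval_poly K A r f \<oplus>\<^bsub>A\<^esub> eval_poly K A r g"
    using eval_poly_superset[OF assms(1,3) W] eval_poly_superset[OF assms(2,3) W] by simp
  finally show ?thesis .
qed

lemma eval_poly_monomial:
  assumes "c \<in> carrier K" "r \<in> UNIV \<rightarrow> carrier A"
  shows "eval_poly K A r (monomial K u c) = c \<odot>\<^bsub>A\<^esub> eval_word A r u"
  using assms
  by (subst eval_poly_superset[where W = "{u}"])
    (auto simp: monomial_def intro: monomial_closed[unfolded monomial_def])

text \<open>Prefixing \<open>u\<close> is injective, so the sum for the product can be reindexed
  over the support of \<open>g\<close>. Scalars are central, so each term splits as a product whose
  left factor comes out of the sum.\<close>

lemma eval_poly_monomial_mult: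
  assumes "c \<in> carrier K" "g \<in> carrier (free_algebra K)" "r \<in> UNIV \<rightarrow> carrier A"
  shows "eval_poly K A r (monomial K u c \<otimes>\<^bsub>free_algebra K\<^esub> g) =
    (c \<odot>\<^bsub>A\<^esub> eval_word A r u) \<otimes>\<^bsub>A\<^esub> eval_poly K A r g"
proof -
  interpret F: assoc_algebra K "free_algebra K" by (rule assoc_algebra_free[OF is_cring])
  let ?V = "{v. g v \<noteq> \<zero>}" and ?h = "monomial K u c \<otimes>\<^bsub>free_algebra K\<^esub> g"
  have h: "?h \<in> carrier (free_algebra K)" using assms by simp
  then have hc: "?h w \<in> carrier K" for w by (simp add: carrier_free_algebra)
  have V: "finite ?V" and g: "g v \<in> carrier K" for v
    using assms(2) by (auto simp: carrier_free_algebra)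
  \<comment> \<open>Only an inclusion: \<open>c \<otimes> g v\<close> may vanish although
    \<open>g v\<close> does not.\<close>
  have "{w. ?h w \<noteq> \<zero>} \<subseteq> (@) u ` ?V"
    using monomial_mult_nonzero[OF assms(1,2)] by blast
  then have "eval_poly K A r ?h = (\<Oplus>\<^bsub>A\<^esub>w\<in>(@) u ` ?V. ?h w \<odot>\<^bsub>A\<^esub> eval_word A r w)"
    using eval_poly_superset[OF h assms(3)] V by blast
  also have "\<dots> = (\<Oplus>\<^bsub>A\<^esub>v\<in>?V. ?h (u @ v) \<odot>\<^bsub>A\<^esub> eval_word A r (u @ v))"
    using assms hc by (subst M.finsum_reindex) (auto simp: inj_on_def)
  also have "\<dots> = (\<Oplus>\<^bsub>A\<^esub>v\<in>?V. (c \<odot>\<^bsub>A\<^esub> eval_word A r u) \<otimes>\<^bsub>A\<^esub> (g v \<odot>\<^bsub>A\<^esub> eval_word A r v))"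
    using assms g
    by (intro M.finsum_cong')
      (auto simp: monomial_mult_append eval_word_append m_comm[of c] smult_assoc1
        smult_mult_left smult_mult_right)
  also have "\<dots> = (c \<odot>\<^bsub>A\<^esub> eval_word A r u) \<otimes>\<^bsub>A\<^esub> eval_poly K A r g"
    unfolding eval_poly_def using assms g V by (subst finsum_rdistr) auto
  finally show ?thesis .
qed

text \<open>Both sides are additive in \<open>f\<close>, so splitting off one monomial of
  \<open>f\<close> at a time reduces the claim to a monomial as left factor.\<close>

lemma eval_poly_mult:
  assumes "f \<in> carrier (free_algebra K)" "g \<in> carrier (free_algebra K)"
    and r: "r \<in> UNIV \<rightarrow> carrier A"
  shows "eval_poly K A r (f \<otimes>\<^bsub>free_algebra K\<^esub> g) = eval_poly K A r f \<otimes>\<^bsub>A\<^esub> eval_poly K A r g"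
proof -
  interpret F: assoc_algebra K "free_algebra K" by (rule assoc_algebra_free[OF is_cring])
  have "finite {w. f w \<noteq> \<zero>}" using assms(1) by (simp add: carrier_free_algebra)
  then show ?thesis using assms(1)
  proof (induction "{w. f w \<noteq> \<zero>}" arbitrary: f rule: finite_induct)
    case empty
    \<comment> \<open>The zero polynomial is written as a monomial so that the monomial lemmas make
      both sides zero.\<close>
    then have "f = monomial K [] \<zero>" by (auto simp: monomial_def)
    then show ?case
      using eval_poly_monomial_mult[OF _ assms(2) r] eval_poly_monomial[OF _ r] by simp
  next
    case (insert u U)
    have c: "f w \<in> carrier K" for w using insert.prems by (simp add: carrier_free_algebra)
    \<comment> \<open>Deleting the term at \<open>u\<close> leaves a polynomial with support exactly
      \<open>U\<close>, to which the induction hypothesis applies.\<close>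
    define f' where "f' = f(u := \<zero>)"
    have U: "U = {w. f' w \<noteq> \<zero>}" using insert.hyps by (auto simp: f'_def)
    then have f': "f' \<in> carrier (free_algebra K)"
      using insert.hyps(1) c by (auto simp: carrier_free_algebra) (simp add: f'_def)
    have "f = monomial K u (f u) \<oplus>\<^bsub>free_algebra K\<^esub> f'"
      using c by (auto simp: fun_eq_iff add_free_algebra monomial_def f'_def)
    moreover have "eval_poly K A r (monomial K u (f u) \<oplus>\<^bsub>free_algebra K\<^esub> f') =
        f u \<odot>\<^bsub>A\<^esub> eval_word A r u \<oplus>\<^bsub>A\<^esub> eval_poly K A r f'"
      using c f' r by (simp add: eval_poly_add eval_poly_monomial)
    moreover have "eval_poly K A r ((monomial K u (f u) \<oplus>\<^bsub>free_algebra K\<^esub> f') \<otimes>\<^bsub>free_algebra K\<^esub> g) =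
        (f u \<odot>\<^bsub>A\<^esub> eval_word A r u) \<otimes>\<^bsub>A\<^esub> eval_poly K A r g \<oplus>\<^bsub>A\<^esub>
        eval_poly K A r f' \<otimes>\<^bsub>A\<^esub> eval_poly K A r g"
      using c f' r assms(2) insert.hyps(3)[OF U f']
      by (simp add: F.l_distr eval_poly_add eval_poly_monomial_mult)
    moreover have "\<dots> = (f u \<odot>\<^bsub>A\<^esub> eval_word A r u \<oplus>\<^bsub>A\<^esub> eval_poly K A r f') \<otimes>\<^bsub>A\<^esub> eval_poly K A r g"
      using c f' r assms(2) by (simp add: l_distr)
    ultimately show ?case by metis
  qed
qed

end

text \<open>Meant for the projection onto a quotient: \<open>h\<close> preserves sums, products and
  scalar multiples, of which the value of a polynomial is built.\<close>

lemma hom_eval_poly: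
  assumes "assoc_algebra K A" "assoc_algebra K B" "h \<in> ring_hom A B"
    and smult: "\<And>c x. \<lbrakk>c \<in> carrier K; x \<in> carrier A\<rbrakk> \<Longrightarrow> h (c \<odot>\<^bsub>A\<^esub> x) = c \<odot>\<^bsub>B\<^esub> h x"
    and f: "f \<in> carrier (free_algebra K)" and r: "r \<in> UNIV \<rightarrow> carrier A"
  shows "h (eval_poly K A r f) = eval_poly K B (h \<circ> r) f"
proof -
  interpret A: assoc_algebra K A by fact
  interpret B: assoc_algebra K B by fact
  interpret h: ring_hom_ring A B h
    by (rule ring_hom_ringI2) (use A.ring_axioms B.ring_axioms assms(3) in auto)
  have c: "f w \<in> carrier K" for w using f by (simp add: carrier_free_algebra)
  have w: "h (eval_word A r w) = eval_word B (h \<circ> r) w" for w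
  proof (induction w)
    case (Cons i w)
    have "r i \<in> carrier A" using r by auto
    then show ?case using Cons r by simp
  qed simp
  have hr: "h \<circ> r \<in> UNIV \<rightarrow> carrier B" using r by (auto simp: Pi_def)
  \<comment> \<open>For infinite \<open>V\<close> both sums take the default value zero.\<close>
  have sum: "h (finsum A t V) = (\<Oplus>\<^bsub>B\<^esub>x\<in>V. h (t x))" if "t \<in> V \<rightarrow> carrier A" for t V
    using that by (induction V rule: infinite_finite_induct) (auto simp: Pi_def)
  show ?thesis
    unfolding eval_poly_def using c r hr
    by (subst sum) (auto simp: smult w intro!: B.M.finsum_cong')
qed

section \<open>Identities of quotients\<close>

lemma satisfies_quot_iff:
  assumes "assoc_algebra K A" "ideal I A" "f \<in> carrier (free_algebra K)"
  shows "satisfies K (quot_algebra A I) f \<longleftrightarrow>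
    (\<forall>r\<in>UNIV \<rightarrow> carrier A. eval_poly K A r f \<in> I)"
proof -
  interpret assoc_algebra K A by fact
  interpret ideal I A by fact
  let ?Q = "quot_algebra A I" and ?h = "(+>\<^bsub>A\<^esub>) I"
  have "?h \<in> ring_hom A ?Q"
    using rcos_ring_hom by (simp add: quot_algebra_def ring_hom_def)
  note eval = hom_eval_poly[OF assms(1) assoc_algebra_quot[OF assms(1,2)] this
      quot_smult[OF assms(1,2), symmetric] assms(3)]
  \<comment> \<open>The projection is surjective, so a sequence of cosets lifts index by index; no
    value of \<open>f\<close> on the quotient is missed.\<close>
  have "\<exists>r\<in>UNIV \<rightarrow> carrier A. s = ?h \<circ> r" if "s \<in> UNIV \<rightarrow> carrier ?Q" for s :: "nat \<Rightarrow> _"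
  proof -
    have "\<forall>i. \<exists>x\<in>carrier A. s i = ?h x"
      using that by (fastforce simp: quot_algebra_def FactRing_def A_RCOSETS_def' Pi_def)
    then obtain r where "\<forall>i. r i \<in> carrier A \<and> s i = ?h (r i)" by metis
    then show ?thesis by (intro bexI[of _ r]) auto
  qed
  moreover have "?h \<circ> r \<in> UNIV \<rightarrow> carrier ?Q" if "r \<in> UNIV \<rightarrow> carrier A" for r :: "nat \<Rightarrow> _"
    using that by (auto simp: quot_algebra_def FactRing_def A_RCOSETS_def' Pi_def)
  ultimately have img: "poly_image K ?Q f = {?h (eval_poly K A r f) | r. r \<in> UNIV \<rightarrow> carrier A}"
    unfolding poly_image_def using eval by (smt (verit) Collect_cong)
  have z: "?h x = \<zero>\<^bsub>?Q\<^esub> \<longleftrightarrow> x \<in> I" if "x \<in> carrier A" for x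
    using that rcos_const_imp_mem a_rcos_zero[OF assms(2)]
    by (auto simp: quot_algebra_def FactRing_def)
  \<comment> \<open>\<open>satisfies\<close> demands that the image equal the zero singleton; a
    constant sequence shows that the image is nonempty.\<close>
  have "(\<lambda>_. \<zero>\<^bsub>A\<^esub>) \<in> UNIV \<rightarrow> carrier A" by simp
  then have "satisfies K ?Q f \<longleftrightarrow> (\<forall>r\<in>UNIV \<rightarrow> carrier A. ?h (eval_poly K A r f) = \<zero>\<^bsub>?Q\<^esub>)"
    unfolding satisfies_def img by blast
  then show ?thesis using z assms(3) by simp
qed

lemma satisfies_P1_identities:
  assumes S: "m_system (free_algebra K) S" and A: "assoc_algebra K A"
  shows "satisfies_P1 A {I. ideal I A \<and> (\<exists>f\<in>S. satisfies K (quot_algebra A I) f)}"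
proof -
  interpret assoc_algebra K A by fact
  interpret F: assoc_algebra K "free_algebra K" by (rule assoc_algebra_free[OF is_cring])
  have SF: "f \<in> carrier (free_algebra K)" if "f \<in> S" for f using S that by (auto simp: m_system_def)
  note sat = satisfies_quot_iff[OF A _ SF]
  show ?thesis
    unfolding satisfies_P1_def
  proof (intro conjI ballI allI impI)
    \<comment> \<open>All values of a polynomial lie in \<open>carrier A\<close>, so any element of
      \<open>S\<close> serves for this ideal, for instance the unit.\<close>
    have "\<one>\<^bsub>free_algebra K\<^esub> \<in> S" using S by (simp add: m_system_def)
    then show "carrier A \<in> {I. ideal I A \<and> (\<exists>f\<in>S. satisfies K (quot_algebra A I) f)}"
      using sat[OF oneideal] oneideal SF by auto
  next
    fix I J assume I: "I \<in> {I. ideal I A \<and> (\<exists>f\<in>S. satisfies K (quot_algebra A I) f)}"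
      and J: "J \<in> {I. ideal I A \<and> (\<exists>f\<in>S. satisfies K (quot_algebra A I) f)}"
    then obtain f g where fg: "f \<in> S" "g \<in> S" "satisfies K (quot_algebra A I) f"
      "satisfies K (quot_algebra A J) g" by blast
    then obtain p where p: "p \<in> carrier (free_algebra K)"
        "f \<otimes>\<^bsub>free_algebra K\<^esub> p \<otimes>\<^bsub>free_algebra K\<^esub> g \<in> S"
      using S unfolding m_system_def by blast
    have IJ: "ideal (I \<cdot>\<^bsub>A\<^esub> J) A" using I J ideal_prod_is_ideal by blast
    have "eval_poly K A r (f \<otimes>\<^bsub>free_algebra K\<^esub> p \<otimes>\<^bsub>free_algebra K\<^esub> g) \<in> I \<cdot>\<^bsub>A\<^esub> J"
      if r: "r \<in> UNIV \<rightarrow> carrier A" for r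
    proof -
      have "eval_poly K A r f \<in> I" "eval_poly K A r g \<in> J"
        using I J fg r sat by blast+
      \<comment> \<open>\<open>I\<close> absorbs the middle value, so this is an element of
        \<open>I\<close> times an element of \<open>J\<close>.\<close>
      then have "eval_poly K A r f \<otimes>\<^bsub>A\<^esub> eval_poly K A r p \<otimes>\<^bsub>A\<^esub> eval_poly K A r g \<in> I \<cdot>\<^bsub>A\<^esub> J"
        using I r p(1) by (intro ideal_prod.prod) (auto intro: ideal.I_r_closed)
      then show ?thesis using r p fg SF by (simp add: eval_poly_mult)
    qed
    then show "I \<cdot>\<^bsub>A\<^esub> J \<in> {I. ideal I A \<and> (\<exists>f\<in>S. satisfies K (quot_algebra A I) f)}"
      using IJ p sat[OF IJ] by blast
  next
    fix I J assume "I \<in> {I. ideal I A \<and> (\<exists>f\<in>S. satisfies K (quot_algebra A I) f)}"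
      and "ideal J A \<and> I \<subseteq> J"
    then show "J \<in> {I. ideal I A \<and> (\<exists>f\<in>S. satisfies K (quot_algebra A I) f)}"
      \<comment> \<open>The criterion that all values of \<open>f\<close> lie in \<open>I\<close>
        passes to every larger ideal, with the same \<open>f\<close>.\<close>
      using sat by blast
  qed auto
qed

section \<open>Monic polynomials\<close>

context cring
begin

lemma monic_poly_mult:
  assumes f: "f \<in> carrier (free_algebra R)" "monic_poly R f"
    and g: "g \<in> carrier (free_algebra R)" "monic_poly R g"
  shows "monic_poly R (f \<otimes>\<^bsub>free_algebra R\<^esub> g)"
proof -
  have c: "f w \<in> carrier R" "g w \<in> carrier R" for w
    using f g by (auto simp: carrier_free_algebra)
  obtain u where u: "f u = \<one>" "\<And>w. f w \<noteq> \<zero> \<Longrightarrow> length w \<le> length u"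
    using f(2) by (auto simp: monic_poly_def)
  obtain v where v: "g v = \<one>" "\<And>w. g w \<noteq> \<zero> \<Longrightarrow> length w \<le> length v"
    using g(2) by (auto simp: monic_poly_def)
  have "(f \<otimes>\<^bsub>free_algebra R\<^esub> g) (u @ v) =
      (\<Oplus>i\<in>{..length (u @ v)}. if length u = i then \<one> else \<zero>)"
    unfolding mult_free_algebra
  proof (rule finsum_cong'[OF refl])
    fix i assume "i \<in> {..length (u @ v)}"
    then have i: "i \<le> length u + length v" by simp
    \<comment> \<open>A cut inside \<open>u\<close> leaves a right part longer than
      \<open>v\<close>, a cut beyond \<open>u\<close> a left part longer than \<open>u\<close>;
      either way a coefficient vanishes.\<close>
    consider "i = length u" | "i < length u" | "length u < i" by linarith
    then show "f (take i (u @ v)) \<otimes> g (drop i (u @ v)) = (if length u = i then \<one> else \<zero>)"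
    proof cases
      case 2
      then have "g (drop i (u @ v)) = \<zero>" using v(2)[of "drop i (u @ v)"] by force
      then show ?thesis using 2 c by simp
    next
      case 3
      then have "f (take i (u @ v)) = \<zero>" using u(2)[of "take i (u @ v)"] i by force
      then show ?thesis using 3 c by simp
    qed (simp add: u v)
  qed auto
  also have "\<dots> = \<one>" by (subst finsum_singleton) auto
  finally have top: "(f \<otimes>\<^bsub>free_algebra R\<^esub> g) (u @ v) = \<one>" .
  have "length w \<le> length (u @ v)" if "(f \<otimes>\<^bsub>free_algebra R\<^esub> g) w \<noteq> \<zero>" for w
  proof (rule ccontr)
    assume long: "\<not> ?thesis"
    have "(f \<otimes>\<^bsub>free_algebra R\<^esub> g) w = (\<Oplus>i\<in>{..length w}. \<zero>)"
      unfolding mult_free_algebra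
    proof (rule finsum_cong'[OF refl])
      fix i assume i: "i \<in> {..length w}"
      \<comment> \<open>The two parts have total length \<open>length w\<close>, which exceeds
        \<open>length u + length v\<close>.\<close>
      then have "length (take i w) > length u \<or> length (drop i w) > length v"
        using long by auto
      then have "f (take i w) = \<zero> \<or> g (drop i w) = \<zero>" using u(2) v(2) leD by blast
      then show "f (take i w) \<otimes> g (drop i w) = \<zero>" using c by auto
    qed simp
    then show False using that by simp
  qed
  then show ?thesis unfolding monic_poly_def using top by blast
qed

lemma m_system_monic:
  "m_system (free_algebra R) {f \<in> carrier (free_algebra R). monic_poly R f}"
proof -
  interpret F: assoc_algebra R "free_algebra R" by (rule assoc_algebra_free[OF is_cring])
  \<comment> \<open>The empty word is the top monomial; over the zero ring the support is empty and
    the length condition holds vacuously.\<close>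
  have one: "monic_poly R \<one>\<^bsub>free_algebra R\<^esub>"
    unfolding monic_poly_def by (intro exI[of _ "[]"]) (auto simp: one_free_algebra)
  show ?thesis
    unfolding m_system_def
  proof (intro conjI ballI)
    fix f g
    assume f: "f \<in> {f \<in> carrier (free_algebra R). monic_poly R f}"
      and g: "g \<in> {f \<in> carrier (free_algebra R). monic_poly R f}"
    \<comment> \<open>Monic polynomials are closed under products, so the middle factor can be the
      unit.\<close>
    then show "\<exists>p\<in>carrier (free_algebra R).
        f \<otimes>\<^bsub>free_algebra R\<^esub> p \<otimes>\<^bsub>free_algebra R\<^esub> g \<in> {f \<in> carrier (free_algebra R). monic_poly R f}"
      using monic_poly_mult by (intro bexI[of _ "\<one>\<^bsub>free_algebra R\<^esub>"]) auto
  qed (use one in auto)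
qed

end

section \<open>Maximal implies prime\<close>

text \<open>In the expansion of a product of two sums, every term other than the one from
  \<open>I\<close> and \<open>J\<close> has a factor in \<open>P\<close>.\<close>

lemma (in ring) ideal_prod_add_subset:
  assumes "ideal I R" "ideal J R" "ideal P R" "I \<cdot> J \<subseteq> P"
  shows "(I <+>\<^bsub>R\<^esub> P) \<cdot> (J <+>\<^bsub>R\<^esub> P) \<subseteq> P"
proof
  interpret P: ideal P R by fact
  fix s assume "s \<in> (I <+>\<^bsub>R\<^esub> P) \<cdot> (J <+>\<^bsub>R\<^esub> P)"
  then show "s \<in> P"
  proof (induction rule: ideal_prod.induct)
    case (prod x y)
    then obtain i p j q where e: "i \<in> I" "p \<in> P" "x = i \<oplus> p" "j \<in> J" "q \<in> P" "y = j \<oplus> q"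
      by (auto simp: set_add_def')
    then have c: "i \<in> carrier R" "j \<in> carrier R" "p \<in> carrier R" "q \<in> carrier R"
      using assms ideal.Icarr by metis+
    have "x \<otimes> y = i \<otimes> j \<oplus> (i \<otimes> q \<oplus> p \<otimes> y)"
      using c e by (simp add: l_distr r_distr a_ac)
    moreover have "i \<otimes> j \<in> P" using ideal_prod.prod[OF e(1,4)] assms(4) by (rule rev_subsetD)
    moreover have "i \<otimes> q \<in> P" "p \<otimes> y \<in> P"
      using c e P.I_l_closed P.I_r_closed by auto
    ultimately show ?case by simp
  qed simp
qed

lemma (in ring) maximal_nonmember_prime:
  assumes F: "satisfies_P1 R \<F>" and P: "ideal P R" "P \<notin> \<F>"
    and maximal: "\<And>J. \<lbrakk>ideal J R; J \<notin> \<F>; P \<subseteq> J\<rbrakk> \<Longrightarrow> J = P"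
  shows "prime_two_sided R P"
  unfolding prime_two_sided_def
proof (intro conjI allI impI)
  have F1: "carrier R \<in> \<F>"
    and F2: "\<forall>I\<in>\<F>. \<forall>J\<in>\<F>. I \<cdot> J \<in> \<F>"
    and F3: "\<forall>I\<in>\<F>. \<forall>J. ideal J R \<and> I \<subseteq> J \<longrightarrow> J \<in> \<F>"
    using F unfolding satisfies_P1_def by metis+
  show "P \<noteq> carrier R" using F1 P(2) by metis
  fix I J assume IJ: "ideal I R \<and> ideal J R \<and> I \<cdot> J \<subseteq> P"
  interpret P: ideal P R by (rule P(1))
  have add: "I <+>\<^bsub>R\<^esub> P \<in> \<F>" if I: "ideal I R" "\<not> I \<subseteq> P" for I
  proof (rule ccontr)
    interpret I: ideal I R by (rule I(1))
    assume n: "I <+>\<^bsub>R\<^esub> P \<notin> \<F>"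
    have "P \<subseteq> I <+>\<^bsub>R\<^esub> P"
    proof
      fix x assume "x \<in> P"
      moreover from this have "x = \<zero> \<oplus> x" using P.Icarr by simp
      ultimately show "x \<in> I <+>\<^bsub>R\<^esub> P" unfolding set_add_def' using I.zero_closed by blast
    qed
    then have "I <+>\<^bsub>R\<^esub> P = P" using maximal add_ideals[OF I(1) P(1)] n by blast
    moreover have "I \<subseteq> I <+>\<^bsub>R\<^esub> P"
    proof
      fix x assume "x \<in> I"
      moreover from this have "x = x \<oplus> \<zero>" using I.Icarr by simp
      ultimately show "x \<in> I <+>\<^bsub>R\<^esub> P" unfolding set_add_def' using P.zero_closed by blast
    qed
    ultimately show False using I(2) by simp
  qed
  show "I \<subseteq> P \<or> J \<subseteq> P"
  proof (rule ccontr)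
    assume "\<not> ?thesis"
    then have "I <+>\<^bsub>R\<^esub> P \<in> \<F>" "J <+>\<^bsub>R\<^esub> P \<in> \<F>" using add IJ by auto
    with F2 have "(I <+>\<^bsub>R\<^esub> P) \<cdot> (J <+>\<^bsub>R\<^esub> P) \<in> \<F>" by metis
    moreover have "(I <+>\<^bsub>R\<^esub> P) \<cdot> (J <+>\<^bsub>R\<^esub> P) \<subseteq> P"
      using IJ P(1) by (intro ideal_prod_add_subset) auto
    \<comment> \<open>Upward closure would put \<open>P\<close> itself into the family.\<close>
    ultimately show False using F3 P by metis
  qed
qed (rule P(1))

theorem proposition3p4:
  fixes K :: "('k, 'n) ring_scheme" and R :: "('k, 'r, 'm) module_scheme"
    and S :: "(nat list \<Rightarrow> 'k) set"
  assumes "cring K"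
    and "m_system (free_algebra K) S"
    and "assoc_algebra K R"
  shows "satisfies_P1 R {I. ideal I R \<and> (\<exists>f\<in>S. satisfies K (quot_algebra R I) f)} \<and>
    (\<forall>I. ideal I R \<and> \<not> PI_algebra K (quot_algebra R I) \<and>
        (\<forall>J. ideal J R \<and> \<not> PI_algebra K (quot_algebra R J) \<and> I \<subseteq> J \<longrightarrow> J = I)
      \<longrightarrow> prime_two_sided R I)"
proof (intro conjI allI impI)
  show "satisfies_P1 R {I. ideal I R \<and> (\<exists>f\<in>S. satisfies K (quot_algebra R I) f)}"
    using assms(2,3) by (rule satisfies_P1_identities)
next
  interpret assoc_algebra K R by fact
  fix I assume I: "ideal I R \<and> \<not> PI_algebra K (quot_algebra R I) \<and>
    (\<forall>J. ideal J R \<and> \<not> PI_algebra K (quot_algebra R J) \<and> I \<subseteq> J \<longrightarrow> J = I)"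
  \<comment> \<open>Here the \<open>m\<close>-system is the set of monic polynomials, not the given
    \<open>S\<close>; its family consists of the ideals with PI quotient.\<close>
  have "satisfies_P1 R {I. ideal I R \<and> PI_algebra K (quot_algebra R I)}"
    using satisfies_P1_identities[OF m_system_monic assms(3)]
    by (simp add: PI_algebra_def Bex_def)
  then show "prime_two_sided R I"
    using I by (intro maximal_nonmember_prime) auto
qed

end
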